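(* Let $T$ be a complete theory with monster model $\mathbb{M}$ and let $\mathop{\smile\!\!\!\!\!\mid}$ be an invariant ternary relation on small subsets of $\mathbb{M}$ satisfying symmetry, full existence, stationarity over models, and the following weak transitivity over models: for all finite tuples $a,b,d$ and every small model $M$, if $a\mathop{\smile\!\!\!\!\!\mid}_{Md}b$, $a\mathop{\smile\!\!\!\!\!\mid}^{h}_M d$ and $b\mathop{\smile\!\!\!\!\!\mid}^{u}_M d$, then $a\mathop{\smile\!\!\!\!\!\mid}_M b$. Then $T$ is $\mathrm{NSOP}_4$.
   Context: Invariance: $a\mathop{\smile\!\!\!\!\!\mid}_C b$ and $\sigma\in\mathrm{Aut}(\mathbb{M})$ imply $\sigma(a)\mathop{\smile\!\!\!\!\!\mid}_{\sigma(C)}\sigma(b)$. Symmetry: $a\mathop{\smile\!\!\!\!\!\mid}_C b$ iff $b\mathop{\smile\!\!\!\!\!\mid}_C a$. Full existence: for all $A,B,C$ there is $A'\equiv_C A$ with $A'\mathop{\smile\!\!\!\!\!\mid}_C B$. Stationarity over models: if $M$ is a model, $a\equiv_M a'$, $a\mathop{\smile\!\!\!\!\!\mid}_M b$ and $a'\mathop{\smile\!\!\!\!\!\mid}_M b$, then $a\equiv_{Mb}a'$. Coheir independence $a\mathop{\smile\!\!\!\!\!\mid}^{u}_M b$ means $\mathrm{tp}(a/Mb)$ is finitely satisfiable in $M$; heir independence $a\mathop{\smile\!\!\!\!\!\mid}^{h}_M b$ means $b\mathop{\smile\!\!\!\!\!\mid}^{u}_M a$. For $n\ge3$, $T$ has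 $\mathrm{SOP}_n$ if there are a type $p(x,y)$ and an indiscernible sequence $(a_i)_{i<\omega}$ with $(a_i,a_j)\models p$ iff $i<j$ and $p(x_0,x_1)\cup\dots\cup p(x_{n-2},x_{n-1})\cup p(x_{n-1},x_0)$ inconsistent; $\mathrm{NSOP}_n$ means not $\mathrm{SOP}_n$. *)

theory Defs
  imports Main
begin

unbundle cardinal_syntax

section \<open>First-order languages, formulas and structures\<close>

record ('f, 'r) lang =
  funs :: "'f set"
  rels :: "'r set"
  farity :: "'f \<Rightarrow> nat"
  rarity :: "'r \<Rightarrow> nat"

datatype 'f tm = Var nat | App 'f "'f tm list"

datatype ('f, 'r) fm =
    Falsum
  | Equal "'f tm" "'f tm"
  | Pred 'r "'f tm list"
  | Imp "('f, 'r) fm" "('f, 'r) fm"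
  | All nat "('f, 'r) fm"

primrec tvars :: "'f tm \<Rightarrow> nat set" where
  "tvars (Var i) = {i}"
| "tvars (App f ts) = \<Union> (set (map tvars ts))"

primrec fvars :: "('f, 'r) fm \<Rightarrow> nat set" where
  "fvars Falsum = {}"
| "fvars (Equal s t) = tvars s \<union> tvars t"
| "fvars (Pred R ts) = \<Union> (set (map tvars ts))"
| "fvars (Imp \<phi> \<psi>) = fvars \<phi> \<union> fvars \<psi>"
| "fvars (All i \<phi>) = fvars \<phi> - {i}"

primrec wf_tm :: "('f, 'r) lang \<Rightarrow> 'f tm \<Rightarrow> bool" where
  "wf_tm L (Var i) = True"
| "wf_tm L (App f ts) =
     (f \<in> funs L \<and> length ts = farity L f \<and> list_all (wf_tm L) ts)"

primrec wf_fm :: "('f, 'r) lang \<Rightarrow> ('f, 'r) fm \<Rightarrow> bool" where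
  "wf_fm L Falsum = True"
| "wf_fm L (Equal s t) = (wf_tm L s \<and> wf_tm L t)"
| "wf_fm L (Pred R ts) =
     (R \<in> rels L \<and> length ts = rarity L R \<and> (\<forall>t\<in>set ts. wf_tm L t))"
| "wf_fm L (Imp \<phi> \<psi>) = (wf_fm L \<phi> \<and> wf_fm L \<psi>)"
| "wf_fm L (All i \<phi>) = wf_fm L \<phi>"

definition sentences :: "('f, 'r) lang \<Rightarrow> ('f, 'r) fm set" where
  "sentences L = {\<phi>. wf_fm L \<phi> \<and> fvars \<phi> = {}}"

text \<open>The values of an interpretation matter only on symbols of the language and on
  argument lists of the right length with entries in the domain.\<close>

record ('f, 'r, 'm) struct =
  dom :: "'m set"
  fint :: "'f \<Rightarrow> 'm list \<Rightarrow> 'm"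
  rint :: "'r \<Rightarrow> 'm list \<Rightarrow> bool"

definition is_struct :: "('f, 'r) lang \<Rightarrow> ('f, 'r, 'm) struct \<Rightarrow> bool" where
  "is_struct L S \<longleftrightarrow> dom S \<noteq> {} \<and>
     (\<forall>f\<in>funs L. \<forall>xs. length xs = farity L f \<longrightarrow> set xs \<subseteq> dom S \<longrightarrow> fint S f xs \<in> dom S)"

primrec tval :: "('f, 'r, 'm) struct \<Rightarrow> (nat \<Rightarrow> 'm) \<Rightarrow> 'f tm \<Rightarrow> 'm" where
  "tval S v (Var i) = v i"
| "tval S v (App f ts) = fint S f (map (tval S v) ts)"

primrec sat :: "('f, 'r, 'm) struct \<Rightarrow> (nat \<Rightarrow> 'm) \<Rightarrow> ('f, 'r) fm \<Rightarrow> bool" where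
  "sat S v Falsum = False"
| "sat S v (Equal s t) = (tval S v s = tval S v t)"
| "sat S v (Pred R ts) = rint S R (map (tval S v) ts)"
| "sat S v (Imp \<phi> \<psi>) = (sat S v \<phi> \<longrightarrow> sat S v \<psi>)"
| "sat S v (All i \<phi>) = (\<forall>x\<in>dom S. sat S (v(i := x)) \<phi>)"

definition models :: "('f, 'r, 'm) struct \<Rightarrow> ('f, 'r) fm set \<Rightarrow> bool" where
  "models S T \<longleftrightarrow> (\<forall>\<phi>\<in>T. \<forall>v. range v \<subseteq> dom S \<longrightarrow> sat S v \<phi>)"

text \<open>Structures are taken with domains in the type of formulas. This type has
  at least max(aleph_0, number of symbols) elements, so by the downward
  Loewenheim-Skolem theorem (and, for finite models, trivially) this is the usual
  consequence relation over all structures.\<close>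

definition entails :: "('f, 'r) lang \<Rightarrow> ('f, 'r) fm set \<Rightarrow> ('f, 'r) fm \<Rightarrow> bool" where
  "entails L T \<phi> \<longleftrightarrow>
     (\<forall>S :: ('f, 'r, ('f, 'r) fm) struct. is_struct L S \<longrightarrow> models S T \<longrightarrow> models S {\<phi>})"

definition complete_theory :: "('f, 'r) lang \<Rightarrow> ('f, 'r) fm set \<Rightarrow> bool" where
  "complete_theory L T \<longleftrightarrow> T \<subseteq> sentences L \<and> \<not> entails L T Falsum \<and>
     (\<forall>\<phi>\<in>sentences L. entails L T \<phi> \<or> entails L T (Imp \<phi> Falsum))"

definition elem_substructure ::
    "('f, 'r) lang \<Rightarrow> ('f, 'r, 'm) struct \<Rightarrow> 'm set \<Rightarrow> bool" where
  "elem_substructure L S M \<longleftrightarrow> M \<subseteq> dom S \<and> is_struct L (S\<lparr>dom := M\<rparr>) \<and>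
     (\<forall>\<phi> v. wf_fm L \<phi> \<longrightarrow> range v \<subseteq> M \<longrightarrow> (sat (S\<lparr>dom := M\<rparr>) v \<phi> \<longleftrightarrow> sat S v \<phi>))"

section \<open>Types\<close>

text \<open>A formula over C in the variables x_0, ..., x_{n-1} is coded as a pair of a
  formula phi without parameters and a list c of elements of C, to be substituted for
  the variables x_n, x_{n+1}, ... of phi.\<close>

definition forms_over :: "('f, 'r) lang \<Rightarrow> nat \<Rightarrow> 'm set \<Rightarrow> (('f, 'r) fm \<times> 'm list) set" where
  "forms_over L n C =
     {(\<phi>, c). wf_fm L \<phi> \<and> set c \<subseteq> C \<and> fvars \<phi> \<subseteq> {..<n + length c}}"

definition realizes ::
    "('f, 'r, 'm) struct \<Rightarrow> 'm list \<Rightarrow> (('f, 'r) fm \<times> 'm list) set \<Rightarrow> bool" where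
  "realizes S a p \<longleftrightarrow> (\<forall>(\<phi>, c)\<in>p. sat S ((!) (a @ c)) \<phi>)"

definition tp ::
    "('f, 'r) lang \<Rightarrow> ('f, 'r, 'm) struct \<Rightarrow> 'm list \<Rightarrow> 'm set \<Rightarrow> (('f, 'r) fm \<times> 'm list) set" where
  "tp L S a C = {(\<phi>, c) \<in> forms_over L (length a) C. sat S ((!) (a @ c)) \<phi>}"

definition fin_satisfiable ::
    "('f, 'r, 'm) struct \<Rightarrow> 'm set \<Rightarrow> nat \<Rightarrow> (('f, 'r) fm \<times> 'm list) set \<Rightarrow> bool" where
  "fin_satisfiable S X n p \<longleftrightarrow>
     (\<forall>q. finite q \<longrightarrow> q \<subseteq> p \<longrightarrow> (\<exists>m. length m = n \<and> set m \<subseteq> X \<and> realizes S m q))"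

text \<open>The map f, restricted to A, preserves types over C. Equivalently, the possibly
  infinite tuples enumerating A and its image under f correspondingly have the same type
  over C; a formula involves only finitely many variables, so it is enough to
  compare finite subtuples.\<close>

definition elementary_map_over ::
    "('f, 'r) lang \<Rightarrow> ('f, 'r, 'm) struct \<Rightarrow> 'm set \<Rightarrow> ('m \<Rightarrow> 'm) \<Rightarrow> 'm set \<Rightarrow> bool" where
  "elementary_map_over L S C f A \<longleftrightarrow> f ` A \<subseteq> dom S \<and>
     (\<forall>xs. set xs \<subseteq> A \<longrightarrow> tp L S (map f xs) C = tp L S xs C)"

definition set_equiv_over ::
    "('f, 'r) lang \<Rightarrow> ('f, 'r, 'm) struct \<Rightarrow> 'm set \<Rightarrow> 'm set \<Rightarrow> 'm set \<Rightarrow> bool" where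
  "set_equiv_over L S C A' A \<longleftrightarrow> (\<exists>f. f ` A = A' \<and> elementary_map_over L S C f A)"

section \<open>Monster models\<close>

definition automorphism ::
    "('f, 'r) lang \<Rightarrow> ('f, 'r, 'm) struct \<Rightarrow> ('m \<Rightarrow> 'm) \<Rightarrow> bool" where
  "automorphism L S \<sigma> \<longleftrightarrow> bij_betw \<sigma> (dom S) (dom S) \<and>
     (\<forall>f\<in>funs L. \<forall>xs. length xs = farity L f \<longrightarrow> set xs \<subseteq> dom S \<longrightarrow>
        \<sigma> (fint S f xs) = fint S f (map \<sigma> xs)) \<and>
     (\<forall>R\<in>rels L. \<forall>xs. length xs = rarity L R \<longrightarrow> set xs \<subseteq> dom S \<longrightarrow>
        (rint S R (map \<sigma> xs) \<longleftrightarrow> rint S R xs))"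

definition small :: "('f, 'r, 'm) struct \<Rightarrow> 'k rel \<Rightarrow> 'm set \<Rightarrow> bool" where
  "small S \<kappa> A \<longleftrightarrow> A \<subseteq> dom S \<and> |A| <o \<kappa>"

definition small_model ::
    "('f, 'r) lang \<Rightarrow> ('f, 'r, 'm) struct \<Rightarrow> 'k rel \<Rightarrow> 'm set \<Rightarrow> bool" where
  "small_model L S \<kappa> M \<longleftrightarrow> small S \<kappa> M \<and> elem_substructure L S M"

definition saturated :: "('f, 'r) lang \<Rightarrow> ('f, 'r, 'm) struct \<Rightarrow> 'k rel \<Rightarrow> bool" where
  "saturated L S \<kappa> \<longleftrightarrow>
     (\<forall>C n p. small S \<kappa> C \<longrightarrow> p \<subseteq> forms_over L n C \<longrightarrow> fin_satisfiable S (dom S) n p \<longrightarrow>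
        (\<exists>a. length a = n \<and> set a \<subseteq> dom S \<and> realizes S a p))"

definition strongly_homogeneous ::
    "('f, 'r) lang \<Rightarrow> ('f, 'r, 'm) struct \<Rightarrow> 'k rel \<Rightarrow> bool" where
  "strongly_homogeneous L S \<kappa> \<longleftrightarrow>
     (\<forall>A f. small S \<kappa> A \<longrightarrow> elementary_map_over L S {} f A \<longrightarrow>
        (\<exists>\<sigma>. automorphism L S \<sigma> \<and> (\<forall>x\<in>A. \<sigma> x = f x)))"

text \<open>The cardinal kappa is an arbitrary one above max(aleph_0, number of symbols); any
  larger choice, e.g. a strong limit, is an instance.\<close>

definition monster_model ::
    "('f, 'r) lang \<Rightarrow> ('f, 'r) fm set \<Rightarrow> ('f, 'r, 'm) struct \<Rightarrow> 'k rel \<Rightarrow> bool" where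
  "monster_model L T S \<kappa> \<longleftrightarrow>
     Card_order \<kappa> \<and> natLeq <o \<kappa> \<and> |funs L| <o \<kappa> \<and> |rels L| <o \<kappa> \<and>
     is_struct L S \<and> models S T \<and> saturated L S \<kappa> \<and> strongly_homogeneous L S \<kappa>"

section \<open>Independence relations\<close>

text \<open>In all that follows, ind A C B reads: A is independent from B over C. Only its
  values on small sets matter. A finite tuple is identified with its set of entries.\<close>

definition coheir_indep ::
    "('f, 'r) lang \<Rightarrow> ('f, 'r, 'm) struct \<Rightarrow> 'm list \<Rightarrow> 'm set \<Rightarrow> 'm list \<Rightarrow> bool" where
  "coheir_indep L S a M b \<longleftrightarrow> fin_satisfiable S M (length a) (tp L S a (M \<union> set b))"

definition heir_indep ::
    "('f, 'r) lang \<Rightarrow> ('f, 'r, 'm) struct \<Rightarrow> 'm list \<Rightarrow> 'm set \<Rightarrow> 'm list \<Rightarrow> bool" where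
  "heir_indep L S a M b \<longleftrightarrow> coheir_indep L S b M a"

definition invariant_rel ::
    "('f, 'r) lang \<Rightarrow> ('f, 'r, 'm) struct \<Rightarrow> 'k rel \<Rightarrow> ('m set \<Rightarrow> 'm set \<Rightarrow> 'm set \<Rightarrow> bool) \<Rightarrow> bool" where
  "invariant_rel L S \<kappa> ind \<longleftrightarrow>
     (\<forall>A B C \<sigma>. small S \<kappa> A \<longrightarrow> small S \<kappa> B \<longrightarrow> small S \<kappa> C \<longrightarrow> automorphism L S \<sigma> \<longrightarrow>
        ind A C B \<longrightarrow> ind (\<sigma> ` A) (\<sigma> ` C) (\<sigma> ` B))"

definition symmetric_rel ::
    "('f, 'r, 'm) struct \<Rightarrow> 'k rel \<Rightarrow> ('m set \<Rightarrow> 'm set \<Rightarrow> 'm set \<Rightarrow> bool) \<Rightarrow> bool" where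
  "symmetric_rel S \<kappa> ind \<longleftrightarrow>
     (\<forall>A B C. small S \<kappa> A \<longrightarrow> small S \<kappa> B \<longrightarrow> small S \<kappa> C \<longrightarrow> (ind A C B \<longleftrightarrow> ind B C A))"

definition full_existence ::
    "('f, 'r) lang \<Rightarrow> ('f, 'r, 'm) struct \<Rightarrow> 'k rel \<Rightarrow> ('m set \<Rightarrow> 'm set \<Rightarrow> 'm set \<Rightarrow> bool) \<Rightarrow> bool" where
  "full_existence L S \<kappa> ind \<longleftrightarrow>
     (\<forall>A B C. small S \<kappa> A \<longrightarrow> small S \<kappa> B \<longrightarrow> small S \<kappa> C \<longrightarrow>
        (\<exists>A'. set_equiv_over L S C A' A \<and> ind A' C B))"

definition stationary_over_models ::
    "('f, 'r) lang \<Rightarrow> ('f, 'r, 'm) struct \<Rightarrow> 'k rel \<Rightarrow> ('m set \<Rightarrow> 'm set \<Rightarrow> 'm set \<Rightarrow> bool) \<Rightarrow> bool" where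
  "stationary_over_models L S \<kappa> ind \<longleftrightarrow>
     (\<forall>M a a' b. small_model L S \<kappa> M \<longrightarrow>
        set a \<subseteq> dom S \<longrightarrow> set a' \<subseteq> dom S \<longrightarrow> set b \<subseteq> dom S \<longrightarrow>
        tp L S a M = tp L S a' M \<longrightarrow> ind (set a) M (set b) \<longrightarrow> ind (set a') M (set b) \<longrightarrow>
        tp L S a (M \<union> set b) = tp L S a' (M \<union> set b))"

definition weakly_transitive_over_models ::
    "('f, 'r) lang \<Rightarrow> ('f, 'r, 'm) struct \<Rightarrow> 'k rel \<Rightarrow> ('m set \<Rightarrow> 'm set \<Rightarrow> 'm set \<Rightarrow> bool) \<Rightarrow> bool" where
  "weakly_transitive_over_models L S \<kappa> ind \<longleftrightarrow>
     (\<forall>M a b d. small_model L S \<kappa> M \<longrightarrow>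
        set a \<subseteq> dom S \<longrightarrow> set b \<subseteq> dom S \<longrightarrow> set d \<subseteq> dom S \<longrightarrow>
        ind (set a) (M \<union> set d) (set b) \<longrightarrow> heir_indep L S a M d \<longrightarrow> coheir_indep L S b M d \<longrightarrow>
        ind (set a) M (set b))"

section \<open>The strong order properties\<close>

definition indiscernible_seq ::
    "('f, 'r) lang \<Rightarrow> ('f, 'r, 'm) struct \<Rightarrow> (nat \<Rightarrow> 'm list) \<Rightarrow> bool" where
  "indiscernible_seq L S a \<longleftrightarrow>
     (\<forall>is js. sorted_wrt (<) is \<longrightarrow> sorted_wrt (<) js \<longrightarrow> length is = length js \<longrightarrow>
        tp L S (concat (map a is)) {} = tp L S (concat (map a js)) {})"

text \<open>For a set p of formulas in two k-tuples of variables x (numbered 0, ..., k - 1) and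
  y (numbered k, ..., 2k - 1): the union of p(x_0,x_1), ..., p(x_{n-2},x_{n-1}),
  p(x_{n-1},x_0) is consistent. A finite part of the union lies in the corresponding
  union for some finite part q of p, and consistency with the complete theory of S is
  finite satisfiability in S.\<close>

definition cycle_consistent ::
    "('f, 'r, 'm) struct \<Rightarrow> nat \<Rightarrow> nat \<Rightarrow> ('f, 'r) fm set \<Rightarrow> bool" where
  "cycle_consistent S n k p \<longleftrightarrow>
     (\<forall>q. finite q \<longrightarrow> q \<subseteq> p \<longrightarrow>
        (\<exists>x :: nat \<Rightarrow> 'm list.
           (\<forall>i<n. length (x i) = k \<and> set (x i) \<subseteq> dom S) \<and>
           (\<forall>i<n. \<forall>\<phi>\<in>q. sat S ((!) (x i @ x (Suc i mod n))) \<phi>)))"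

text \<open>The property SOP_n (n at least 3) of the complete theory of S, evaluated in its
  monster model S.\<close>

definition SOP :: "nat \<Rightarrow> ('f, 'r) lang \<Rightarrow> ('f, 'r, 'm) struct \<Rightarrow> bool" where
  "SOP n L S \<longleftrightarrow>
     (\<exists>k p a. p \<subseteq> {\<phi>. wf_fm L \<phi> \<and> fvars \<phi> \<subseteq> {..<2 * k}} \<and>
        (\<forall>i. length (a i) = k \<and> set (a i) \<subseteq> dom S) \<and>
        indiscernible_seq L S a \<and>
        (\<forall>i j. (\<forall>\<phi>\<in>p. sat S ((!) (a i @ a j)) \<phi>) \<longleftrightarrow> i < j) \<and>
        \<not> cycle_consistent S n k p)"

abbreviation NSOP :: "nat \<Rightarrow> ('f, 'r) lang \<Rightarrow> ('f, 'r, 'm) struct \<Rightarrow> bool" where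
  "NSOP n L S \<equiv> \<not> SOP n L S"

end

theory Submission
  imports Defs "HOL.Filter"
begin

text \<open>Suppose that p and a sequence witness the strong order property. Averaging the sequence along
  an ultrafilter, over a small model M that contains it, gives y and z of the same type over M such
  that p(y, z) holds and tp(y / Mz) is finitely satisfiable in M. An automorphism over M carrying z
  to y carries y to some x, and p(x, y) holds. Full existence moves z over My to some z' that is
  independent from x over My, and weak transitivity makes z' and x independent over M. As z' and x
  have the same type over M, symmetry and stationarity show that (z', x) and (x, z') have the same
  type over M. So the path x, y, z' along p has a conjugate z', y', x, which closes it to a cycle of
  length 4.\<close>

section \<open>Cardinality bounds and ultrafilters\<close>

lemma card_of_Times_bound:
  assumes "infinite B" "|X| \<le>o |B|" "|Y| \<le>o |B|"
  shows "|X \<times> Y| \<le>o |B|"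
  using assms card_of_Times_ordLeq_infinite_Field[of "|B|" X Y]
  by (simp add: Field_card_of card_of_card_order_on)

lemma card_of_Plus_bound:
  assumes "infinite B" "|X| \<le>o |B|" "|Y| \<le>o |B|"
  shows "|X <+> Y| \<le>o |B|"
  using assms card_of_Plus_ordLeq_infinite_Field[of "|B|" X Y]
  by (simp add: Field_card_of card_of_card_order_on)

lemma card_of_Un_bound:
  assumes "infinite B" "|X| \<le>o |B|" "|Y| \<le>o |B|"
  shows "|X \<union> Y| \<le>o |B|"
  using assms card_of_Un_ordLeq_infinite_Field[of "|B|" X Y]
  by (simp add: Field_card_of card_of_card_order_on)

lemma card_of_image_bound: "|X| \<le>o |B| \<Longrightarrow> |f ` X| \<le>o |B|"
  using card_of_image ordLeq_transitive by blast

lemma card_of_nat_bound: "infinite B \<Longrightarrow> |UNIV :: nat set| \<le>o |B|"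
  using infinite_iff_card_of_nat by blast

lemma card_of_lists_length_ordLeq:
  fixes X :: "'a set"
  assumes "infinite B" and "|X| \<le>o |B|"
  shows "|{xs. length xs = n \<and> set xs \<subseteq> X}| \<le>o |B|"
proof (induction n)
  case 0
  have "{xs. length xs = 0 \<and> set xs \<subseteq> X} = {[]}"
    by auto
  then show ?case
    using assms(1) card_of_singl_ordLeq[of B "[] :: 'a list"] by force
next
  case (Suc n)
  let ?P = "X \<times> {xs. length xs = n \<and> set xs \<subseteq> X}"
  have "{xs. length xs = Suc n \<and> set xs \<subseteq> X} \<subseteq> (\<lambda>(x, xs). x # xs) ` ?P"
    by (auto simp: length_Suc_conv image_iff)
  then have "|{xs. length xs = Suc n \<and> set xs \<subseteq> X}| \<le>o |(\<lambda>(x, xs). x # xs) ` ?P|"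
    by (rule card_of_mono1)
  moreover have "|(\<lambda>(x, xs). x # xs) ` ?P| \<le>o |B|"
    using assms Suc by (intro card_of_image_bound card_of_Times_bound)
  ultimately show ?case
    by (rule ordLeq_transitive)
qed

lemma card_of_lists_ordLeq:
  assumes "infinite B" and "|X| \<le>o |B|"
  shows "|lists X| \<le>o |B|"
proof -
  have "lists X = (\<Union>n::nat. {xs. length xs = n \<and> set xs \<subseteq> X})"
    by auto
  then show ?thesis
    using card_of_UNION_ordLeq_infinite[OF assms(1) card_of_nat_bound[OF assms(1)]]
      card_of_lists_length_ordLeq[OF assms] by (metis (no_types, lifting))
qed

text \<open>Terms, formulas and elementary hulls are all counted through this closure. The
  operations take lists of every length, so one statement covers symbols of all arities, and a
  constant is a value at \<open>[]\<close>. The set is the union of the stages \<open>C n\<close>: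
  an infinite \<open>B\<close> absorbs products, finite lists and countable unions, and a list over
  the union lies in a single stage since the stages increase.\<close>

lemma bounded_closed_set:
  fixes g :: "'i \<Rightarrow> 'a list \<Rightarrow> 'a"
  assumes inf: "infinite B" and I: "|I| \<le>o |B|"
  shows "\<exists>X. |X| \<le>o |B| \<and> (\<forall>i\<in>I. \<forall>xs\<in>lists X. g i xs \<in> X)"
proof -
  define F where "F X = X \<union> (\<lambda>(i, xs). g i xs) ` (I \<times> lists X)" for X
  define C where "C n = (F ^^ n) {}" for n :: nat
  have C_Suc: "C (Suc n) = F (C n)" for n
    by (simp add: C_def)
  have "mono C"
    unfolding mono_iff_le_Suc by (auto simp: C_Suc F_def)
  have bound: "|C n| \<le>o |B|" for n
  proof (induction n)
    case 0
    then show ?case using card_of_empty by (simp add: C_def)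
  next
    case (Suc n)
    have "|I \<times> lists (C n)| \<le>o |B|"
      using inf I card_of_lists_ordLeq[OF inf Suc] by (rule card_of_Times_bound)
    then show ?case
      unfolding C_Suc F_def using inf Suc by (intro card_of_Un_bound card_of_image_bound)
  qed
  have "\<exists>n. set xs \<subseteq> C n" if "set xs \<subseteq> (\<Union>n. C n)" for xs
    using that
  proof (induction xs)
    case (Cons x xs)
    then obtain m n where "x \<in> C m" "set xs \<subseteq> C n"
      by auto
    then have "set (x # xs) \<subseteq> C (max m n)"
      using monoD[OF \<open>mono C\<close>, of m "max m n"] monoD[OF \<open>mono C\<close>, of n "max m n"] by auto
    then show ?case ..
  qed simp
  note finite_stage = this
  have "g i xs \<in> (\<Union>n. C n)" if "i \<in> I" "xs \<in> lists (\<Union>n. C n)" for i xs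
  proof -
    obtain n where "set xs \<subseteq> C n"
      using finite_stage[of xs] \<open>xs \<in> lists (\<Union>n. C n)\<close> by auto
    then have "g i xs \<in> C (Suc n)"
      using \<open>i \<in> I\<close> by (auto simp: C_Suc F_def image_iff)
    then show ?thesis by blast
  qed
  moreover have "|\<Union>n. C n| \<le>o |B|"
    using card_of_UNION_ordLeq_infinite[OF inf card_of_nat_bound[OF inf], of C] bound by blast
  ultimately show ?thesis by blast
qed

text \<open>Zorn's lemma, applied to the proper filters below \<open>F0\<close> in reversed order:
  finer filters are smaller for \<open>\<le>\<close>, so the ultrafilters are the minimal ones. If
  \<open>F\<close> is minimal, its meet with the principal filter of \<open>P\<close> is
  \<open>bot\<close> or \<open>F\<close> itself; in the first case \<open>F\<close> contains the
  negation of \<open>P\<close>, in the second \<open>P\<close>.\<close>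

lemma ultrafilter_exists:
  assumes "F0 \<noteq> bot"
  obtains F where "F \<le> F0" "F \<noteq> bot" "\<And>P. eventually P F \<or> eventually (\<lambda>x. \<not> P x) F"
proof -
  let ?A = "{F. F \<noteq> bot \<and> F \<le> F0}"
  have "\<exists>m\<in>?A. \<forall>a\<in>?A. m \<ge> a \<longrightarrow> a = m"
  proof (rule predicate_Zorn)
    show "partial_order_on ?A (relation_of (\<ge>) ?A)"
      by (rule partial_order_on_relation_ofI) auto
  next
    fix C assume C: "C \<in> Chains (relation_of (\<ge>) ?A)"
    show "\<exists>u\<in>?A. \<forall>a\<in>C. a \<ge> u"
    proof (cases "C = {}")
      case True
      then show ?thesis using assms by auto
    next
      case False
      have sub: "C \<subseteq> ?A" and tot: "\<And>F G. F \<in> C \<Longrightarrow> G \<in> C \<Longrightarrow> F \<le> G \<or> G \<le> F"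
        using C unfolding Chains_def relation_of_def by auto
      \<comment> \<open>Along a chain, an event of \<open>Inf C\<close> is already an event of some
        member, so \<open>Inf C\<close> is proper because every member is.\<close>
      have "\<exists>x\<in>C. x \<le> inf F G" if "F \<in> C" "G \<in> C" for F G
        using tot[OF that] that by (metis inf.absorb1 inf.absorb2 order_refl)
      then have "eventually P (Inf C) \<longleftrightarrow> (\<exists>b\<in>C. eventually P b)" for P
        by (rule eventually_Inf_base[OF False])
      then have "Inf C \<noteq> bot"
        using sub by (auto simp: trivial_limit_def)
      moreover have "Inf C \<le> F0"
        using False sub by (metis (no_types, lifting) Inf_lower2 ex_in_conv mem_Collect_eq subsetD)
      ultimately show ?thesis
        by (auto intro: Inf_lower)
    qed
  qed
  then obtain F where F: "F \<noteq> bot" "F \<le> F0" and minimal: "\<And>G. G \<noteq> bot \<Longrightarrow> G \<le> F \<Longrightarrow> G = F"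
    by (metis (mono_tags, lifting) mem_Collect_eq order_trans)
  have "eventually P F \<or> eventually (\<lambda>x. \<not> P x) F" for P
  proof (cases "inf F (principal {x. P x}) = bot")
    case True
    then show ?thesis
      by (auto simp: trivial_limit_def eventually_inf_principal)
  next
    case False
    then have "inf F (principal {x. P x}) = F"
      by (intro minimal) auto
    then have "F \<le> principal {x. P x}"
      by (metis inf.cobounded2)
    then show ?thesis
      by (simp add: le_principal)
  qed
  with F show ?thesis using that by blast
qed

section \<open>Renaming, automorphisms and elementary substructures\<close>

lemma finite_tvars: "finite (tvars t)"
  by (induction t) auto

lemma finite_fvars: "finite (fvars \<phi>)"
  by (induction \<phi>) (auto simp: finite_tvars)

lemma tval_cong: "(\<And>i. i \<in> tvars t \<Longrightarrow> v i = w i) \<Longrightarrow> tval S v t = tval S w t"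
proof (induction t)
  case (App f ts)
  have "tval S v t = tval S w t" if "t \<in> set ts" for t
    using that App.prems by (intro App.IH) auto
  then show ?case by (simp cong: map_cong)
next
  case (Var i) show ?case by (simp add: Var)
qed

lemma sat_cong: "(\<And>i. i \<in> fvars \<phi> \<Longrightarrow> v i = w i) \<Longrightarrow> sat S v \<phi> = sat S w \<phi>"
proof (induction \<phi> arbitrary: v w)
  case (Equal s t)
  have "tval S v s = tval S w s" "tval S v t = tval S w t"
    by (rule tval_cong; simp add: Equal)+
  then show ?case by simp
next
  case (Pred R ts)
  have "map (tval S v) ts = map (tval S w) ts"
    by (rule map_cong[OF refl], rule tval_cong) (use Pred.prems in auto)
  then show ?case by (simp del: map_eq_conv)
next
  case (Imp \<phi> \<psi>)
  have "sat S v \<phi> = sat S w \<phi>"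
    by (rule Imp.IH) (simp add: Imp.prems)
  moreover have "sat S v \<psi> = sat S w \<psi>"
    by (rule Imp.IH) (simp add: Imp.prems)
  ultimately show ?case by simp
next
  case (All i \<phi>)
  have "sat S (v(i := x)) \<phi> = sat S (w(i := x)) \<phi>" for x
    by (rule All.IH) (simp add: All.prems)
  then show ?case by simp
next
  case Falsum show ?case by simp
qed

primrec tren :: "(nat \<Rightarrow> nat) \<Rightarrow> 'f tm \<Rightarrow> 'f tm" where
  "tren \<rho> (Var i) = Var (\<rho> i)"
| "tren \<rho> (App f ts) = App f (map (tren \<rho>) ts)"

text \<open>Bound variables are renamed to fresh ones, so there is no capture even if \<open>\<rho>\<close> is not
  injective.\<close>

primrec ren :: "(nat \<Rightarrow> nat) \<Rightarrow> ('f, 'r) fm \<Rightarrow> ('f, 'r) fm" where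
  "ren \<rho> Falsum = Falsum"
| "ren \<rho> (Equal s t) = Equal (tren \<rho> s) (tren \<rho> t)"
| "ren \<rho> (Pred R ts) = Pred R (map (tren \<rho>) ts)"
| "ren \<rho> (Imp \<phi> \<psi>) = Imp (ren \<rho> \<phi>) (ren \<rho> \<psi>)"
| "ren \<rho> (All i \<phi>) =
     (let z = Suc (Max (insert 0 (\<rho> ` fvars \<phi>))) in All z (ren (\<rho>(i := z)) \<phi>))"

lemma tvars_tren: "tvars (tren \<rho> t) = \<rho> ` tvars t"
  by (induction t) auto

lemma fresh_variable:
  assumes "n \<in> fvars \<phi>"
  shows "\<rho> n \<noteq> Suc (Max (insert 0 (\<rho> ` fvars \<phi>)))"
proof -
  have "\<rho> n \<le> Max (insert 0 (\<rho> ` fvars \<phi>))"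
    using assms finite_fvars by (intro Max_ge) auto
  then show ?thesis by linarith
qed

lemma fvars_ren: "fvars (ren \<rho> \<phi>) \<subseteq> \<rho> ` fvars \<phi>"
proof (induction \<phi> arbitrary: \<rho>)
  case (All i \<phi>)
  define z where "z = Suc (Max (insert 0 (\<rho> ` fvars \<phi>)))"
  have "fvars (ren (\<rho>(i := z)) \<phi>) \<subseteq> insert z (\<rho> ` (fvars \<phi> - {i}))"
    using All[of "\<rho>(i := z)"] by (rule order_trans) auto
  then have "fvars (ren (\<rho>(i := z)) \<phi>) - {z} \<subseteq> \<rho> ` (fvars \<phi> - {i})"
    by blast
  then show ?case
    by (simp only: ren.simps fvars.simps Let_def z_def)
qed (auto simp: tvars_tren, blast+)

lemma wf_tm_tren: "wf_tm L t \<Longrightarrow> wf_tm L (tren \<rho> t)"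
  by (induction t) (auto simp: list_all_iff)

lemma wf_fm_ren: "wf_fm L \<phi> \<Longrightarrow> wf_fm L (ren \<rho> \<phi>)"
  by (induction \<phi> arbitrary: \<rho>) (auto simp: wf_tm_tren Let_def)

lemma tval_tren: "tval S v (tren \<rho> t) = tval S (\<lambda>k. v (\<rho> k)) t"
proof (induction t)
  case (App f ts)
  have "map (tval S v \<circ> tren \<rho>) ts = map (tval S (\<lambda>k. v (\<rho> k))) ts"
    by (rule map_cong[OF refl]) (simp add: App)
  then show ?case by (simp del: map_eq_conv)
qed simp

lemma sat_ren: "sat S v (ren \<rho> \<phi>) = sat S (\<lambda>k. v (\<rho> k)) \<phi>"
proof (induction \<phi> arbitrary: \<rho> v)
  case (Pred R ts)
  have "map (tval S v \<circ> tren \<rho>) ts = map (tval S (\<lambda>k. v (\<rho> k))) ts"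
    by (rule map_cong[OF refl]) (simp add: tval_tren)
  then show ?case by (simp del: map_eq_conv)
next
  case (All i \<phi>)
  let ?z = "Suc (Max (insert 0 (\<rho> ` fvars \<phi>)))"
  \<comment> \<open>The two assignments could differ only at some \<open>k\<close> other than
    \<open>i\<close> with \<open>\<rho> k = ?z\<close>, and freshness of \<open>?z\<close> excludes
    this for the free variables of \<open>\<phi>\<close>.\<close>
  have "sat S (\<lambda>k. (v(?z := x)) ((\<rho>(i := ?z)) k)) \<phi> = sat S ((\<lambda>k. v (\<rho> k))(i := x)) \<phi>" for x
    by (rule sat_cong) (use fresh_variable in auto)
  then show ?case by (simp add: Let_def All)
qed (auto simp: tval_tren)

section \<open>Automorphisms preserve satisfaction\<close>

lemma tval_in_dom:
  assumes "is_struct L S" "range v \<subseteq> dom S"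
  shows "wf_tm L t \<Longrightarrow> tval S v t \<in> dom S"
proof (induction t)
  case (App f ts)
  have "set (map (tval S v) ts) \<subseteq> dom S"
    using App by (auto simp: list_all_iff)
  then show ?case
    using App.prems assms(1) unfolding is_struct_def by auto
qed (use assms in auto)

text \<open>A list assignment \<open>(!) xs\<close> has unspecified values beyond the length of
  \<open>xs\<close>, whereas the induction for automorphisms runs over assignments with all values
  in the domain. This passes from the former to the latter.\<close>

lemma sat_extend:
  assumes "dom S \<noteq> {}" "v ` fvars \<phi> \<subseteq> dom S"
  obtains w where "range w \<subseteq> dom S" "\<And>i. i \<in> fvars \<phi> \<Longrightarrow> w i = v i"
proof -
  obtain d where "d \<in> dom S" using assms(1) by blast
  then show ?thesis
    using that[of "\<lambda>i. if i \<in> fvars \<phi> then v i else d"] assms(2) by auto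
qed

lemma tval_automorphism:
  assumes "is_struct L S" "automorphism L S \<sigma>" "range v \<subseteq> dom S"
  shows "wf_tm L t \<Longrightarrow> tval S (\<lambda>k. \<sigma> (v k)) t = \<sigma> (tval S v t)"
proof (induction t)
  case (App f ts)
  have "map (tval S (\<lambda>k. \<sigma> (v k))) ts = map \<sigma> (map (tval S v) ts)"
    using App by (auto simp: list_all_iff)
  moreover have "set (map (tval S v) ts) \<subseteq> dom S"
    using App.prems tval_in_dom[OF assms(1,3)] by (auto simp: list_all_iff)
  ultimately show ?case
    using App.prems assms(2) unfolding automorphism_def by (simp del: map_eq_conv map_map)
qed simp

text \<open>Injectivity of \<open>\<sigma>\<close> settles equations, and surjectivity settles
  quantifiers, where \<open>\<sigma> x\<close> has to run through the whole domain.\<close>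

lemma sat_automorphism_range:
  assumes "is_struct L S" "automorphism L S \<sigma>"
  shows "wf_fm L \<phi> \<Longrightarrow> range v \<subseteq> dom S \<Longrightarrow> sat S (\<lambda>k. \<sigma> (v k)) \<phi> = sat S v \<phi>"
proof (induction \<phi> arbitrary: v)
  case (Equal s t)
  have "inj_on \<sigma> (dom S)"
    using assms(2) unfolding automorphism_def bij_betw_def by blast
  then show ?case
    using Equal tval_automorphism[OF assms Equal(2)] tval_in_dom[OF assms(1) Equal(2)]
    by (simp add: inj_on_eq_iff)
next
  case (Pred R ts)
  have "map (tval S (\<lambda>k. \<sigma> (v k))) ts = map \<sigma> (map (tval S v) ts)"
    using Pred tval_automorphism[OF assms Pred(2)] by auto
  moreover have "set (map (tval S v) ts) \<subseteq> dom S"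
    using Pred tval_in_dom[OF assms(1) Pred(2)] by auto
  ultimately show ?case
    using Pred(1) assms(2) unfolding automorphism_def by (simp del: map_eq_conv map_map)
next
  case (All i \<phi>)
  have onto: "\<sigma> ` dom S = dom S"
    using assms(2) unfolding automorphism_def bij_betw_def by blast
  have "sat S ((\<lambda>k. \<sigma> (v k))(i := \<sigma> x)) \<phi> = sat S (v(i := x)) \<phi>" if "x \<in> dom S" for x
  proof -
    have "(\<lambda>k. \<sigma> (v k))(i := \<sigma> x) = (\<lambda>k. \<sigma> ((v(i := x)) k))"
      by auto
    then show ?thesis
      using All.IH[of "v(i := x)"] All.prems that by (simp add: image_subset_iff fun_upd_def)
  qed
  then have "(\<forall>x\<in>\<sigma> ` dom S. sat S ((\<lambda>k. \<sigma> (v k))(i := x)) \<phi>) = (\<forall>x\<in>dom S. sat S (v(i := x)) \<phi>)"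
    by simp
  then show ?case
    by (simp add: onto)
qed auto

lemma sat_automorphism:
  assumes "is_struct L S" "automorphism L S \<sigma>" "wf_fm L \<phi>" "v ` fvars \<phi> \<subseteq> dom S"
  shows "sat S (\<lambda>k. \<sigma> (v k)) \<phi> = sat S v \<phi>"
proof -
  have "dom S \<noteq> {}"
    using assms(1) unfolding is_struct_def by blast
  then obtain w where w: "range w \<subseteq> dom S" "\<And>i. i \<in> fvars \<phi> \<Longrightarrow> w i = v i"
    using sat_extend[OF _ assms(4)] by blast
  have "sat S (\<lambda>k. \<sigma> (v k)) \<phi> = sat S (\<lambda>k. \<sigma> (w k)) \<phi>" "sat S v \<phi> = sat S w \<phi>"
    using w(2) by (auto intro!: sat_cong)
  then show ?thesis
    using sat_automorphism_range[OF assms(1-3) w(1)] by simp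
qed

lemma sat_map_automorphism:
  assumes "is_struct L S" "automorphism L S \<sigma>" "wf_fm L \<phi>"
    "fvars \<phi> \<subseteq> {..<length xs}" "set xs \<subseteq> dom S"
  shows "sat S ((!) (map \<sigma> xs)) \<phi> = sat S ((!) xs) \<phi>"
proof -
  have "sat S ((!) (map \<sigma> xs)) \<phi> = sat S (\<lambda>k. \<sigma> (xs ! k)) \<phi>"
    using assms(4) by (intro sat_cong) auto
  also have "\<dots> = sat S ((!) xs) \<phi>"
    using assms by (intro sat_automorphism) (auto dest!: subsetD)
  finally show ?thesis .
qed

section \<open>Counting formulas and the downward Loewenheim-Skolem theorem\<close>

lemma wf_tm_bound:
  fixes L :: "('a, 'r) lang"
  assumes inf: "infinite B" and "|funs L| \<le>o |B|"
  shows "|{t. wf_tm L t}| \<le>o |B|"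
proof -
  \<comment> \<open>Arities are not checked, so the closure may contain ill-formed terms, which is
    harmless for an upper bound.\<close>
  define g :: "'a + nat \<Rightarrow> 'a tm list \<Rightarrow> 'a tm" where
    "g i ts = (case i of Inl f \<Rightarrow> App f ts | Inr n \<Rightarrow> Var n)" for i ts
  have "|funs L <+> (UNIV :: nat set)| \<le>o |B|"
    using assms by (intro card_of_Plus_bound card_of_nat_bound)
  from bounded_closed_set[OF inf this, of g]
  obtain X where X: "|X| \<le>o |B|"
    and closed: "\<And>i xs. i \<in> funs L <+> UNIV \<Longrightarrow> xs \<in> lists X \<Longrightarrow> g i xs \<in> X"
    by blast
  have "wf_tm L t \<Longrightarrow> t \<in> X" for t
  proof (induction t)
    case (Var i)
    then show ?case using closed[OF InrI[OF UNIV_I], of "[]" i] by (simp add: g_def)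
  next
    case (App f ts)
    then have "ts \<in> lists X" by (auto simp: list_all_iff)
    then show ?case using App.prems closed[of "Inl f" ts] by (auto simp: g_def)
  qed
  then have "{t. wf_tm L t} \<subseteq> X" by blast
  then show ?thesis using X card_of_mono1 ordLeq_transitive by blast
qed

lemma wf_fm_bound:
  fixes L :: "('f, 'r) lang"
  assumes inf: "infinite B" and "|funs L| \<le>o |B|" "|rels L| \<le>o |B|"
  shows "|{\<phi>. wf_fm L \<phi>}| \<le>o |B|"
proof -
  let ?T = "{t. wf_tm L t}"
  define At :: "('f, 'r) fm set" where
    "At = ({Falsum} \<union> (\<lambda>(s, t). Equal s t) ` (?T \<times> ?T)) \<union> (\<lambda>(R, ts). Pred R ts) ` (rels L \<times> lists ?T)"
  \<comment> \<open>\<open>Inl \<phi>\<close> yields an atomic formula, \<open>Inr 0\<close> an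
    implication, and \<open>Inr (Suc i)\<close> a quantification over the variable
    \<open>i\<close>.\<close>
  define g :: "('f, 'r) fm + nat \<Rightarrow> ('f, 'r) fm list \<Rightarrow> ('f, 'r) fm" where
    "g i \<phi>s = (case i of Inl \<phi> \<Rightarrow> \<phi> | Inr 0 \<Rightarrow> Imp (\<phi>s ! 0) (\<phi>s ! 1)
        | Inr (Suc i) \<Rightarrow> All i (\<phi>s ! 0))" for i \<phi>s
  have T: "|?T| \<le>o |B|"
    using wf_tm_bound assms by blast
  have "|At| \<le>o |B|"
    unfolding At_def using inf T assms(3)
    by (intro card_of_Un_bound card_of_image_bound card_of_Times_bound card_of_lists_ordLeq
        card_of_singl_ordLeq) auto
  then have "|At <+> (UNIV :: nat set)| \<le>o |B|"
    using inf by (intro card_of_Plus_bound card_of_nat_bound)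
  from bounded_closed_set[OF inf this, of g]
  obtain X where X: "|X| \<le>o |B|"
    and closed: "\<And>i xs. i \<in> At <+> UNIV \<Longrightarrow> xs \<in> lists X \<Longrightarrow> g i xs \<in> X"
    by blast
  have atom: "\<phi> \<in> X" if "\<phi> \<in> At" for \<phi>
    using closed[OF InlI[OF that], of "[]"] by (simp add: g_def)
  have "wf_fm L \<phi> \<Longrightarrow> \<phi> \<in> X" for \<phi>
  proof (induction \<phi>)
    case Falsum
    show ?case by (rule atom) (simp add: At_def)
  next
    case (Equal s t)
    then show ?case by (intro atom) (auto simp: At_def)
  next
    case (Pred R ts)
    then show ?case by (intro atom) (auto simp: At_def)
  next
    case (Imp \<phi> \<psi>)
    then show ?case using closed[OF InrI[OF UNIV_I], of "[\<phi>, \<psi>]" 0] by (simp add: g_def)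
  next
    case (All i \<phi>)
    then show ?case using closed[OF InrI[OF UNIV_I], of "[\<phi>]" "Suc i"] by (simp add: g_def)
  qed
  then have "{\<phi>. wf_fm L \<phi>} \<subseteq> X" by blast
  then show ?thesis using X card_of_mono1 ordLeq_transitive by blast
qed

lemma tval_dom_update [simp]: "tval (S\<lparr>dom := M\<rparr>) v t = tval S v t"
proof (induction t)
  case (App f ts)
  have "map (tval (S\<lparr>dom := M\<rparr>) v) ts = map (tval S v) ts"
    by (rule map_cong[OF refl]) (simp add: App)
  then show ?case by (simp del: map_eq_conv)
qed simp

text \<open>The condition speaks of counterexamples because \<open>All\<close> is the primitive
  quantifier: a universal formula that fails in the large structure must already fail at an element
  of \<open>M\<close>.\<close>

lemma tarski_vaught:
  assumes "M \<subseteq> dom S"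
    and witness: "\<And>\<phi> i v. wf_fm L \<phi> \<Longrightarrow> range v \<subseteq> M \<Longrightarrow> \<exists>x\<in>dom S. \<not> sat S (v(i := x)) \<phi> \<Longrightarrow>
      \<exists>x\<in>M. \<not> sat S (v(i := x)) \<phi>"
  shows "wf_fm L \<phi> \<Longrightarrow> range v \<subseteq> M \<Longrightarrow> sat (S\<lparr>dom := M\<rparr>) v \<phi> = sat S v \<phi>"
proof (induction \<phi> arbitrary: v)
  case (Pred R ts)
  have "map (tval (S\<lparr>dom := M\<rparr>) v) ts = map (tval S v) ts"
    by (rule map_cong[OF refl]) simp
  then show ?case by (simp del: map_eq_conv)
next
  case (All i \<phi>)
  have "sat (S\<lparr>dom := M\<rparr>) (v(i := x)) \<phi> = sat S (v(i := x)) \<phi>" if "x \<in> M" for x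
    using All that by (intro All.IH) auto
  then show ?case
    using witness[of \<phi> v i] All.prems assms(1) by auto
qed auto

text \<open>The model is a Skolem hull of \<open>A\<close>: it is closed under the function symbols
  and under a choice of counterexamples, so the Tarski-Vaught criterion applies, and the count of
  formulas bounds its size.\<close>

lemma downward_loewenheim_skolem:
  fixes L :: "('f, 'r) lang" and S :: "('f, 'r, 'm) struct"
  assumes S: "is_struct L S" and A: "A \<subseteq> dom S" "|A| \<le>o |B|"
    and inf: "infinite B" and L: "|funs L| \<le>o |B|" "|rels L| \<le>o |B|"
  obtains M where "A \<subseteq> M" "elem_substructure L S M" "|M| \<le>o |B|"
proof -
  obtain d where d: "d \<in> dom S"
    using S unfolding is_struct_def by blast
  \<comment> \<open>This is a Skolem function for the negation of \<open>All i \<phi>\<close> with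
    parameters \<open>c\<close>; the value \<open>d\<close> is a default when no counterexample
    exists.\<close>
  define w where "w \<phi> i c = (if \<exists>x\<in>dom S. \<not> sat S (((!) c)(i := x)) \<phi>
      then SOME x. x \<in> dom S \<and> \<not> sat S (((!) c)(i := x)) \<phi> else d)"
    for \<phi> :: "('f, 'r) fm" and i :: nat and c :: "'m list"
  have w_dom: "w \<phi> i c \<in> dom S" for \<phi> i c
  proof (cases "\<exists>x\<in>dom S. \<not> sat S (((!) c)(i := x)) \<phi>")
    case True
    then have "\<exists>x. x \<in> dom S \<and> \<not> sat S (((!) c)(i := x)) \<phi>"
      by blast
    from someI_ex[OF this] show ?thesis
      using True unfolding w_def by simp
  next
    case False
    then show ?thesis using d unfolding w_def by simp
  qed
  have w_sat: "\<not> sat S (((!) c)(i := w \<phi> i c)) \<phi>" if "\<exists>x\<in>dom S. \<not> sat S (((!) c)(i := x)) \<phi>" for \<phi> i c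
  proof -
    have "\<exists>x. x \<in> dom S \<and> \<not> sat S (((!) c)(i := x)) \<phi>"
      using that by blast
    from someI_ex[OF this] show ?thesis
      using that unfolding w_def by simp
  qed
  define g :: "('m + ('f, 'r) fm \<times> nat) + 'f \<Rightarrow> 'm list \<Rightarrow> 'm" where
    "g k c = (case k of Inl (Inl a) \<Rightarrow> a | Inl (Inr (\<phi>, i)) \<Rightarrow> w \<phi> i c
       | Inr f \<Rightarrow> if length c = farity L f then fint S f c else d)" for k c
  let ?I = "(A <+> ({\<phi>. wf_fm L \<phi>} \<times> (UNIV :: nat set))) <+> funs L"
  have "|?I| \<le>o |B|"
    using inf A(2) L
    by (intro card_of_Plus_bound card_of_Times_bound wf_fm_bound card_of_nat_bound)
  from bounded_closed_set[OF inf this, of g]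
  obtain X where X: "|X| \<le>o |B|" and closed: "\<And>k c. k \<in> ?I \<Longrightarrow> c \<in> lists X \<Longrightarrow> g k c \<in> X"
    by blast
  \<comment> \<open>Nothing places the closed set \<open>X\<close> inside the domain. The
    intersection stays closed, as the operations have values in the domain when their arguments come
    from it.\<close>
  define M where "M = X \<inter> dom S"
  have AM: "A \<subseteq> M"
    using closed[of "Inl (Inl _)" "[]"] A(1) by (auto simp: g_def M_def)
  have w_M: "w \<phi> i c \<in> M" if "wf_fm L \<phi>" "set c \<subseteq> M" for \<phi> i c
    using closed[of "Inl (Inr (\<phi>, i))" c] that w_dom by (auto simp: g_def M_def)
  have f_M: "fint S f c \<in> M" if "f \<in> funs L" "length c = farity L f" "set c \<subseteq> M" for f c
    using closed[of "Inr f" c] that S unfolding is_struct_def by (auto simp: g_def M_def)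
  \<comment> \<open>\<open>A\<close> may be empty; the Skolem value for \<open>Falsum\<close>
    supplies an element.\<close>
  have "M \<noteq> {}"
    using w_M[of Falsum "[]"] by auto
  then have "is_struct L (S\<lparr>dom := M\<rparr>)"
    using f_M unfolding is_struct_def by auto
  moreover have "\<exists>x\<in>M. \<not> sat S (v(i := x)) \<phi>"
    if "wf_fm L \<phi>" "range v \<subseteq> M" "\<exists>x\<in>dom S. \<not> sat S (v(i := x)) \<phi>" for \<phi> i v
  proof -
    obtain n where n: "fvars \<phi> \<subseteq> {..<n}"
      using finite_nat_set_iff_bounded[of "fvars \<phi>"] finite_fvars by auto
    \<comment> \<open>Skolem functions take lists, so the assignment is cut down to a finite list
      that covers the free variables.\<close>
    define c where "c = map v [0..<n]"
    have eq: "sat S (((!) c)(i := x)) \<phi> = sat S (v(i := x)) \<phi>" for x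
      using n by (intro sat_cong) (auto simp: c_def)
    have "w \<phi> i c \<in> M"
      using that by (intro w_M) (auto simp: c_def)
    moreover have "\<not> sat S (v(i := w \<phi> i c)) \<phi>"
      using w_sat[of c i \<phi>] that(3) by (simp add: eq)
    ultimately show ?thesis by blast
  qed
  ultimately have "elem_substructure L S M"
    unfolding elem_substructure_def using tarski_vaught[of M S L] by (auto simp: M_def)
  moreover have "|M| \<le>o |B|"
    using X card_of_mono1[of M X] ordLeq_transitive by (auto simp: M_def)
  ultimately show ?thesis
    using that AM by blast
qed

section \<open>Types\<close>

lemma mem_tp_iff:
  "(\<phi>, c) \<in> tp L S a C \<longleftrightarrow>
     wf_fm L \<phi> \<and> set c \<subseteq> C \<and> fvars \<phi> \<subseteq> {..<length a + length c} \<and> sat S ((!) (a @ c)) \<phi>"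
  by (simp add: tp_def forms_over_def conj_assoc)

lemma tp_mono_eq:
  assumes "tp L S a D = tp L S a' D" "length a = length a'" "C \<subseteq> D"
  shows "tp L S a C = tp L S a' C"
proof -
  have "(\<phi>, c) \<in> tp L S a C \<longleftrightarrow> (\<phi>, c) \<in> tp L S a' C" for \<phi> c
    using assms(1)[THEN eqset_imp_iff, of "(\<phi>, c)"] assms(2,3) by (auto simp: mem_tp_iff)
  then show ?thesis by auto
qed

text \<open>Equality of types compares formulas only at \<open>a @ c\<close> and
  \<open>a' @ c\<close>. Renaming variables by a suitable \<open>\<rho>\<close> carries this over to
  all corresponding lists \<open>xs\<close> and \<open>ys\<close>, in any order and with
  repetitions; \<open>c\<close> collects the entries of \<open>xs\<close> that lie in
  \<open>C\<close>.\<close>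

lemma sat_eq_of_tp_eq:
  assumes tp: "tp L S a C = tp L S a' C" and len: "length a = length a'"
    and \<phi>: "wf_fm L \<phi>" "fvars \<phi> \<subseteq> {..<length xs}"
    and rel: "\<And>i. i < length xs \<Longrightarrow>
      xs ! i \<in> C \<and> ys ! i = xs ! i \<or> (\<exists>j<length a. xs ! i = a ! j \<and> ys ! i = a' ! j)"
  shows "sat S ((!) xs) \<phi> = sat S ((!) ys) \<phi>"
proof -
  define c where "c = filter (\<lambda>x. x \<in> C) xs"
  have "\<exists>m. m < length (a @ c) \<and> (a @ c) ! m = xs ! i \<and> (a' @ c) ! m = ys ! i"
    if "i < length xs" for i
    using rel[OF that]
  proof
    assume "xs ! i \<in> C \<and> ys ! i = xs ! i"
    moreover from this have "xs ! i \<in> set c"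
      using that by (simp add: c_def)
    then obtain m where "m < length c" "c ! m = xs ! i"
      by (auto simp: in_set_conv_nth)
    ultimately show ?thesis
      using len by (intro exI[of _ "length a + m"]) (simp add: nth_append)
  next
    assume "\<exists>j<length a. xs ! i = a ! j \<and> ys ! i = a' ! j"
    then show ?thesis
      using len by (metis length_append nth_append trans_less_add1)
  qed
  then obtain \<rho> where \<rho>: "\<And>i. i < length xs \<Longrightarrow>
      \<rho> i < length (a @ c) \<and> (a @ c) ! \<rho> i = xs ! i \<and> (a' @ c) ! \<rho> i = ys ! i"
    by metis
  have xs: "sat S ((!) (a @ c)) (ren \<rho> \<phi>) = sat S ((!) xs) \<phi>"
    unfolding sat_ren using \<rho> \<phi>(2) by (intro sat_cong) auto
  have ys: "sat S ((!) (a' @ c)) (ren \<rho> \<phi>) = sat S ((!) ys) \<phi>"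
    unfolding sat_ren using \<rho> \<phi>(2) by (intro sat_cong) auto
  have "fvars (ren \<rho> \<phi>) \<subseteq> {..<length a + length c}"
    using fvars_ren[of \<rho> \<phi>] \<phi>(2) \<rho> by fastforce
  moreover have "set c \<subseteq> C"
    by (auto simp: c_def)
  ultimately have "sat S ((!) (a @ c)) (ren \<rho> \<phi>) = sat S ((!) (a' @ c)) (ren \<rho> \<phi>)"
    using tp[THEN eqset_imp_iff, of "(ren \<rho> \<phi>, c)"] len wf_fm_ren[OF \<phi>(1)]
    by (simp add: mem_tp_iff)
  then show ?thesis
    by (simp add: xs ys)
qed

text \<open>The correspondence that fixes \<open>C\<close> and takes each \<open>a ! j\<close> to
  \<open>a' ! j\<close> is an elementary map, which strong homogeneity extends.\<close>

lemma automorphism_of_tp_eq: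
  assumes hom: "strongly_homogeneous L S \<kappa>" and sm: "small S \<kappa> (C \<union> set a)"
    and a': "set a' \<subseteq> dom S" and len: "length a = length a'"
    and tp: "tp L S a C = tp L S a' C"
  obtains \<sigma> where "automorphism L S \<sigma>" "\<And>x. x \<in> C \<Longrightarrow> \<sigma> x = x" "map \<sigma> a = a'"
proof -
  define R where "R x y \<longleftrightarrow> x \<in> C \<and> y = x \<or> (\<exists>j<length a. x = a ! j \<and> y = a' ! j)" for x y
  define f where "f x = (SOME y. R x y)" for x
  \<comment> \<open>The tuple \<open>a\<close> may repeat entries or meet \<open>C\<close>. The
    equation of two variables holds at \<open>[x, x]\<close>, hence at \<open>[y, y']\<close>, so
    the correspondence is a function.\<close>
  have unique: "y = y'" if "R x y" "R x y'" for x y y'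
  proof -
    have "sat S ((!) [x, x]) (Equal (Var 0) (Var 1)) = sat S ((!) [y, y']) (Equal (Var 0) (Var 1))"
      by (rule sat_eq_of_tp_eq[OF tp len]) (use that in \<open>auto simp: R_def less_Suc_eq\<close>)
    then show ?thesis by simp
  qed
  have "\<exists>y. R x y" if "x \<in> C \<union> set a" for x
    using that unfolding R_def by (auto simp: in_set_conv_nth)
  then have R: "R x (f x)" if "x \<in> C \<union> set a" for x
    unfolding f_def using that by (metis someI_ex)
  have f_C: "f x = x" if "x \<in> C" for x
    using unique[OF R[of x], of x] that by (simp add: R_def)
  have f_a: "map f a = a'"
  proof (rule nth_equalityI)
    fix j assume "j < length (map f a)"
    then have "R (a ! j) (f (a ! j))" "R (a ! j) (a' ! j)"
      using R[of "a ! j"] by (auto simp: R_def)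
    then show "map f a ! j = a' ! j"
      using unique \<open>j < length (map f a)\<close> by simp
  qed (simp add: len)
  have "elementary_map_over L S {} f (C \<union> set a)"
    unfolding elementary_map_over_def
  proof (intro conjI allI impI)
    have "f ` set a = set a'"
      using f_a by auto
    then show "f ` (C \<union> set a) \<subseteq> dom S"
      using sm a' f_C by (auto simp: small_def image_Un)
  next
    fix xs assume xs: "set xs \<subseteq> C \<union> set a"
    have "sat S ((!) xs) \<phi> = sat S ((!) (map f xs)) \<phi>"
      if "wf_fm L \<phi>" "fvars \<phi> \<subseteq> {..<length xs}" for \<phi>
    proof (rule sat_eq_of_tp_eq[OF tp len that])
      fix i assume "i < length xs"
      then have "R (xs ! i) (f (xs ! i))"
        using xs R[of "xs ! i"] by (meson nth_mem subsetD)
      then show "xs ! i \<in> C \<and> map f xs ! i = xs ! i \<or>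
          (\<exists>j<length a. xs ! i = a ! j \<and> map f xs ! i = a' ! j)"
        using \<open>i < length xs\<close> by (simp add: R_def)
    qed
    then show "tp L S (map f xs) {} = tp L S xs {}"
      by (auto simp: mem_tp_iff)
  qed
  with hom sm obtain \<sigma> where "automorphism L S \<sigma>" "\<forall>x\<in>C \<union> set a. \<sigma> x = f x"
    unfolding strongly_homogeneous_def by blast
  then show ?thesis
    using that[of \<sigma>] f_C f_a by (metis UnI1 UnI2 map_eq_conv)
qed

section \<open>Conjugation of types and coheirs; limit types along an ultrafilter\<close>

lemma tp_map_automorphism:
  assumes S: "is_struct L S" "automorphism L S \<sigma>" and C: "C \<subseteq> dom S" "\<And>x. x \<in> C \<Longrightarrow> \<sigma> x = x"
    and a: "set a \<subseteq> dom S"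
  shows "tp L S (map \<sigma> a) C = tp L S a C"
proof -
  have "sat S ((!) (map \<sigma> a @ c)) \<phi> = sat S ((!) (a @ c)) \<phi>"
    if "wf_fm L \<phi>" "set c \<subseteq> C" "fvars \<phi> \<subseteq> {..<length a + length c}" for \<phi> c
  proof -
    have "map \<sigma> c = c"
      using C(2) that(2) by (simp add: map_idI subset_iff)
    then have "map \<sigma> a @ c = map \<sigma> (a @ c)"
      by simp
    then show ?thesis
      using sat_map_automorphism[OF S that(1), of "a @ c"] that C(1) a by auto
  qed
  then show ?thesis
    by (auto simp: mem_tp_iff)
qed

text \<open>A finite part of the type of \<open>map \<sigma> a\<close> is pulled back along
  \<open>\<sigma>\<close> and realized by some \<open>m\<close> in \<open>M\<close>. As
  \<open>\<sigma>\<close> fixes \<open>m\<close>, the same \<open>m\<close> realizes the original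
  part.\<close>

lemma coheir_indep_map_automorphism:
  assumes S: "is_struct L S" "automorphism L S \<sigma>" and M: "M \<subseteq> dom S" "\<And>x. x \<in> M \<Longrightarrow> \<sigma> x = x"
    and ab: "set a \<subseteq> dom S" "set b \<subseteq> dom S" and ind: "coheir_indep L S a M b"
  shows "coheir_indep L S (map \<sigma> a) M (map \<sigma> b)"
  unfolding coheir_indep_def fin_satisfiable_def
proof (intro allI impI)
  fix q assume q: "finite q" "q \<subseteq> tp L S (map \<sigma> a) (M \<union> set (map \<sigma> b))"
  have "q \<subseteq> (\<lambda>(\<phi>, c). (\<phi>, map \<sigma> c)) ` tp L S a (M \<union> set b)"
  proof (rule subsetI, clarify)
    fix \<phi> c assume "(\<phi>, c) \<in> q"
    then have \<phi>: "wf_fm L \<phi>" "set c \<subseteq> M \<union> \<sigma> ` set b" "fvars \<phi> \<subseteq> {..<length a + length c}"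
      "sat S ((!) (map \<sigma> a @ c)) \<phi>"
      using subsetD[OF q(2) \<open>(\<phi>, c) \<in> q\<close>] by (simp_all add: mem_tp_iff)
    have "M \<union> \<sigma> ` set b = \<sigma> ` (M \<union> set b)"
      using M(2) by (auto simp: image_Un)
    then have "c \<in> lists (\<sigma> ` (M \<union> set b))"
      using \<phi>(2) by auto
    then obtain c' where c': "set c' \<subseteq> M \<union> set b" "c = map \<sigma> c'"
      unfolding lists_image by auto
    have "set (a @ c') \<subseteq> dom S"
      using c'(1) M(1) ab by auto
    then have "sat S ((!) (a @ c')) \<phi>"
      using sat_map_automorphism[OF S \<phi>(1), of "a @ c'"] \<phi>(3,4) c'(2) by simp
    then have "(\<phi>, c') \<in> tp L S a (M \<union> set b)"
      using \<phi> c' by (simp add: mem_tp_iff)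
    then show "(\<phi>, c) \<in> (\<lambda>(\<phi>, c). (\<phi>, map \<sigma> c)) ` tp L S a (M \<union> set b)"
      using c'(2) by force
  qed
  from finite_subset_image[OF q(1) this]
  obtain q' where q': "finite q'" "q' \<subseteq> tp L S a (M \<union> set b)"
    "q = (\<lambda>(\<phi>, c). (\<phi>, map \<sigma> c)) ` q'"
    by blast
  from ind[unfolded coheir_indep_def fin_satisfiable_def, rule_format, OF q'(1,2)]
  obtain m where m: "length m = length a" "set m \<subseteq> M" "realizes S m q'"
    by blast
  have "sat S ((!) (m @ map \<sigma> c)) \<phi>" if "(\<phi>, c) \<in> q'" for \<phi> c
  proof -
    have \<phi>: "wf_fm L \<phi>" "set c \<subseteq> M \<union> set b" "fvars \<phi> \<subseteq> {..<length a + length c}"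
      using subsetD[OF q'(2) that] by (simp_all add: mem_tp_iff)
    have "map \<sigma> m = m"
      using m(2) M(2) by (simp add: map_idI subset_iff)
    then have "m @ map \<sigma> c = map \<sigma> (m @ c)"
      by simp
    moreover have "sat S ((!) (m @ c)) \<phi>"
      using m(3) that unfolding realizes_def by auto
    moreover have "set (m @ c) \<subseteq> dom S"
      using \<phi>(2) m(2) M(1) ab by auto
    ultimately show ?thesis
      using sat_map_automorphism[OF S \<phi>(1), of "m @ c"] \<phi>(3) m(1) by simp
  qed
  then have "realizes S m q"
    unfolding realizes_def q'(3) by auto
  then show "\<exists>m. length m = length (map \<sigma> a) \<and> set m \<subseteq> M \<and> realizes S m q"
    using m by auto
qed

text \<open>If \<open>U\<close> is an ultrafilter, this is a complete type over \<open>C\<close>, finitely satisfiable in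
  every set that contains all entries of the tuples \<open>a i\<close>.\<close>

definition limit_tp ::
    "('f, 'r) lang \<Rightarrow> ('f, 'r, 'm) struct \<Rightarrow> 'i filter \<Rightarrow> ('i \<Rightarrow> 'm list) \<Rightarrow> nat \<Rightarrow> 'm set \<Rightarrow>
      (('f, 'r) fm \<times> 'm list) set" where
  "limit_tp L S U a n C =
     {(\<phi>, c) \<in> forms_over L n C. eventually (\<lambda>i. sat S ((!) (a i @ c)) \<phi>) U}"

text \<open>Each member of the limit type holds on a set of indices in \<open>U\<close>, so finitely
  many members hold together at some \<open>i\<close>, and \<open>a i\<close> is the
  witness.\<close>

lemma fin_satisfiable_limit_tp:
  assumes "U \<noteq> bot" "\<And>i. length (a i) = n \<and> set (a i) \<subseteq> X"
  shows "fin_satisfiable S X n (limit_tp L S U a n C)"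
  unfolding fin_satisfiable_def
proof (intro allI impI)
  fix q assume "finite q" "q \<subseteq> limit_tp L S U a n C"
  then have "eventually (\<lambda>i. \<forall>x\<in>q. sat S ((!) (a i @ snd x)) (fst x)) U"
    by (intro eventually_ball_finite) (auto simp: limit_tp_def)
  then obtain i where "\<forall>x\<in>q. sat S ((!) (a i @ snd x)) (fst x)"
    using assms(1) eventually_happens' by blast
  then show "\<exists>m. length m = n \<and> set m \<subseteq> X \<and> realizes S m q"
    using assms(2) unfolding realizes_def by (intro exI[of _ "a i"]) auto
qed

text \<open>Saturation realizes the limit type. An ultrafilter decides between \<open>\<phi>\<close>
  and its negation \<open>Imp \<phi> Falsum\<close>, so the limit type is complete and must be the
  whole type of its realization.\<close>

lemma realize_limit_tp:
  assumes sat: "saturated L S \<kappa>" and C: "small S \<kappa> C"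
    and U: "U \<noteq> bot" "\<And>P. eventually P U \<or> eventually (\<lambda>i. \<not> P i) U"
    and a: "\<And>i. length (a i) = n \<and> set (a i) \<subseteq> dom S"
  obtains e where "length e = n" "set e \<subseteq> dom S" "tp L S e C = limit_tp L S U a n C"
proof -
  have "fin_satisfiable S (dom S) n (limit_tp L S U a n C)"
    using fin_satisfiable_limit_tp[of U a n "dom S"] U(1) a by blast
  moreover have "limit_tp L S U a n C \<subseteq> forms_over L n C"
    by (auto simp: limit_tp_def)
  ultimately obtain e where e: "length e = n" "set e \<subseteq> dom S" "realizes S e (limit_tp L S U a n C)"
    using sat C unfolding saturated_def by blast
  have real: "sat S ((!) (e @ c)) \<phi>" if "(\<phi>, c) \<in> limit_tp L S U a n C" for \<phi> c
    using e(3) that unfolding realizes_def by auto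
  have "(\<phi>, c) \<in> limit_tp L S U a n C" if "(\<phi>, c) \<in> tp L S e C" for \<phi> c
  proof (rule ccontr)
    assume "(\<phi>, c) \<notin> limit_tp L S U a n C"
    then have "(Imp \<phi> Falsum, c) \<in> limit_tp L S U a n C"
      using that e(1) U(2) by (auto simp: limit_tp_def tp_def forms_over_def)
    then show False
      using real that by (auto simp: mem_tp_iff dest!: real)
  qed
  moreover have "(\<phi>, c) \<in> tp L S e C" if "(\<phi>, c) \<in> limit_tp L S U a n C" for \<phi> c
    using real[OF that] that e(1) by (auto simp: limit_tp_def tp_def)
  ultimately have "tp L S e C = limit_tp L S U a n C"
    by auto
  with e that show ?thesis by blast
qed

section \<open>Small sets, small models and a coheir pair\<close>

lemma infinite_Field_of_natLeq_ordLess: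
  assumes "Card_order \<kappa>" "natLeq <o \<kappa>"
  shows "infinite (Field \<kappa>)"
proof -
  have "natLeq \<le>o |Field \<kappa>|"
    using assms card_of_Field_ordIso ordIso_symmetric ordLess_imp_ordLeq ordLeq_ordIso_trans by blast
  then have "|UNIV :: nat set| \<le>o |Field \<kappa>|"
    using card_of_nat ordIso_ordLeq_trans by blast
  then show ?thesis
    using infinite_iff_card_of_nat by blast
qed

lemma small_Un:
  assumes "Card_order \<kappa>" "natLeq <o \<kappa>" "small S \<kappa> A" "small S \<kappa> B"
  shows "small S \<kappa> (A \<union> B)"
  using assms card_of_Un_ordLess_infinite_Field[OF infinite_Field_of_natLeq_ordLess, of \<kappa> A B]
  unfolding small_def by blast

lemma small_countable:
  assumes "natLeq <o \<kappa>" "A \<subseteq> dom S" "|A| \<le>o |UNIV :: nat set|"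
  shows "small S \<kappa> A"
proof -
  have "|A| \<le>o natLeq"
    using assms(3) card_of_nat ordLeq_ordIso_trans by blast
  then show ?thesis
    using assms(1,2) ordLeq_ordLess_trans unfolding small_def by blast
qed

lemma card_of_set_ordLeq_nat: "|set a| \<le>o |UNIV :: nat set|"
proof -
  obtain f :: "'a \<Rightarrow> nat" where "inj_on f (set a)"
    using finite_imp_inj_to_nat_seg[of "set a"] by auto
  then show ?thesis
    using card_of_ordLeq[of "set a" "UNIV :: nat set"] by blast
qed

lemma small_set: "natLeq <o \<kappa> \<Longrightarrow> set a \<subseteq> dom S \<Longrightarrow> small S \<kappa> (set a)"
  by (rule small_countable[OF _ _ card_of_set_ordLeq_nat])

lemma monster_small_model:
  fixes L :: "('f, 'r) lang" and S :: "('f, 'r, 'm) struct"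
  assumes mon: "monster_model L T S \<kappa>" and A: "A \<subseteq> dom S" "|A| \<le>o |UNIV :: nat set|"
  obtains M where "A \<subseteq> M" "small_model L S \<kappa> M"
proof -
  \<comment> \<open>This set is infinite and at least as large as the language and \<open>A\<close>;
    it stays below \<open>\<kappa>\<close> because an infinite cardinal is closed under sums of
    smaller ones.\<close>
  let ?B = "(funs L <+> rels L) <+> (UNIV :: nat set)"
  have \<kappa>: "Card_order \<kappa>" "natLeq <o \<kappa>" "|funs L| <o \<kappa>" "|rels L| <o \<kappa>" and S: "is_struct L S"
    using mon unfolding monster_model_def by auto
  have "|UNIV :: nat set| <o \<kappa>"
    using \<kappa>(2) card_of_nat ordIso_ordLess_trans by blast
  then have B: "|?B| <o \<kappa>"
    using \<kappa> infinite_Field_of_natLeq_ordLess[OF \<kappa>(1,2)]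
    by (intro card_of_Plus_ordLess_infinite_Field)
  have "|funs L| \<le>o |?B|" "|rels L| \<le>o |?B|"
    using card_of_Plus1[of "funs L" "rels L"] card_of_Plus2[of "rels L" "funs L"]
      card_of_Plus1[of "funs L <+> rels L" "UNIV :: nat set"] ordLeq_transitive by blast+
  moreover have "infinite ?B" "|A| \<le>o |?B|"
    using card_of_Plus2[of "UNIV :: nat set" "funs L <+> rels L"] A(2) ordLeq_transitive
      infinite_iff_card_of_nat by blast+
  ultimately obtain M where M: "A \<subseteq> M" "elem_substructure L S M" "|M| \<le>o |?B|"
    using downward_loewenheim_skolem[OF S A(1), of ?B] by blast
  have "|M| <o \<kappa>"
    using M(3) B ordLeq_ordLess_trans by blast
  then have "small_model L S \<kappa> M"
    using M(2) unfolding small_model_def small_def elem_substructure_def by blast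
  with M(1) that show ?thesis by blast
qed

text \<open>The order is reversed: \<open>e\<close>, realized first, stands for a late term of the sequence
  and \<open>d\<close> for an earlier one, since the inner limit of \<open>p(a i, a j)\<close> must run over \<open>j > i\<close>.\<close>

lemma coheir_pair_of_increasing_sequence:
  fixes a :: "nat \<Rightarrow> 'm list"
  assumes mon: "monster_model L T S \<kappa>"
    and p: "p \<subseteq> {\<phi>. wf_fm L \<phi> \<and> fvars \<phi> \<subseteq> {..<2 * k}}"
    and a: "\<And>i. length (a i) = k \<and> set (a i) \<subseteq> dom S"
    and increasing: "\<forall>i j. i < j \<longrightarrow> (\<forall>\<phi>\<in>p. sat S ((!) (a i @ a j)) \<phi>)"
  obtains M d e where "small_model L S \<kappa> M" "length d = k" "length e = k"
    "set d \<subseteq> dom S" "set e \<subseteq> dom S" "tp L S d M = tp L S e M" "coheir_indep L S d M e"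
    "\<forall>\<phi>\<in>p. sat S ((!) (d @ e)) \<phi>"
proof -
  have \<kappa>: "Card_order \<kappa>" "natLeq <o \<kappa>" and sat: "saturated L S \<kappa>"
    using mon unfolding monster_model_def by auto
  have "|\<Union>i. set (a i)| \<le>o |UNIV :: nat set|"
    using card_of_UNION_ordLeq_infinite[of "UNIV :: nat set" "UNIV :: nat set" "\<lambda>i. set (a i)"]
      card_of_set_ordLeq_nat card_of_refl ordIso_imp_ordLeq by auto
  moreover have "(\<Union>i. set (a i)) \<subseteq> dom S"
    using a by blast
  ultimately obtain M where M: "(\<Union>i. set (a i)) \<subseteq> M" "small_model L S \<kappa> M"
    using monster_small_model[OF mon] by blast
  have smM: "small S \<kappa> M"
    using M(2) unfolding small_model_def by blast
  \<comment> \<open>An ultrafilter that refines \<open>sequentially\<close> contains every tail,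
    which is what the inner limit over \<open>j > i\<close> needs.\<close>
  obtain U :: "nat filter" where U: "U \<le> sequentially" "U \<noteq> bot"
    "\<And>P. eventually P U \<or> eventually (\<lambda>i. \<not> P i) U"
    using ultrafilter_exists[of sequentially] by auto
  obtain e where e: "length e = k" "set e \<subseteq> dom S" "tp L S e M = limit_tp L S U a k M"
    by (rule realize_limit_tp[OF sat smM U(2,3) a])
  have smMe: "small S \<kappa> (M \<union> set e)"
    using small_Un[OF \<kappa> smM small_set[OF \<kappa>(2) e(2)]] .
  obtain d where d: "length d = k" "set d \<subseteq> dom S"
    "tp L S d (M \<union> set e) = limit_tp L S U a k (M \<union> set e)"
    by (rule realize_limit_tp[OF sat smMe U(2,3) a])
  \<comment> \<open>Both types are limits of the same sequence along \<open>U\<close>, and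
    membership in a limit type does not depend on the parameter set once it contains
    \<open>c\<close>.\<close>
  have "(\<phi>, c) \<in> tp L S d M \<longleftrightarrow> (\<phi>, c) \<in> tp L S e M" for \<phi> c
  proof -
    have "(\<phi>, c) \<in> tp L S d M \<longleftrightarrow> set c \<subseteq> M \<and> (\<phi>, c) \<in> tp L S d (M \<union> set e)"
      by (auto simp: mem_tp_iff)
    also have "\<dots> \<longleftrightarrow> (\<phi>, c) \<in> tp L S e M"
      unfolding d(3) e(3) limit_tp_def forms_over_def by auto
    finally show ?thesis .
  qed
  then have "tp L S d M = tp L S e M"
    by auto
  moreover have "coheir_indep L S d M e"
    unfolding coheir_indep_def d(1,3) using M(1) a U(2) by (intro fin_satisfiable_limit_tp) auto
  moreover have "sat S ((!) (d @ e)) \<phi>" if "\<phi> \<in> p" for \<phi>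
  proof -
    have \<phi>: "wf_fm L \<phi>" "fvars \<phi> \<subseteq> {..<k + k}"
      using subsetD[OF p that] by (simp_all add: mult_2)
    \<comment> \<open>In a type the realizing tuple comes before the parameters. Exchanging the two
      halves of the variables lets \<open>\<phi>(a i, e)\<close> be read as a formula about
      \<open>e\<close> with parameters \<open>a i\<close>.\<close>
    define \<rho> where "\<rho> i = (if i < k then k + i else i - k)" for i
    have \<rho>: "sat S ((!) (y @ x)) (ren \<rho> \<phi>) = sat S ((!) (x @ y)) \<phi>"
      if "length x = k" "length y = k" for x y
      unfolding sat_ren using \<phi>(2) that by (intro sat_cong) (auto simp: \<rho>_def nth_append)
    have "fvars (ren \<rho> \<phi>) \<subseteq> {..<k + k}"
      using fvars_ren[of \<rho> \<phi>] \<phi>(2) by (fastforce simp: \<rho>_def)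
    then have "(ren \<rho> \<phi>, a i) \<in> tp L S e M \<longleftrightarrow> sat S ((!) (a i @ e)) \<phi>" for i
      using M(1) a[of i] e(1) \<rho>[of "a i" e] wf_fm_ren[OF \<phi>(1)] by (auto simp: mem_tp_iff)
    moreover have "(ren \<rho> \<phi>, a i) \<in> tp L S e M" for i
    proof -
      \<comment> \<open>Inner limit: for fixed \<open>i\<close>, \<open>\<phi>(a i, a j)\<close>
        holds for all \<open>j > i\<close>, which gives \<open>\<phi>(a i, e)\<close>.\<close>
      have "eventually (\<lambda>j. i < j) U"
        using U(1) eventually_gt_at_top filter_leD by blast
      then have "eventually (\<lambda>j. sat S ((!) (a j @ a i)) (ren \<rho> \<phi>)) U"
        by (rule eventually_mono) (use increasing that a \<rho> in auto)
      then show ?thesis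
        using M(1) a[of i] \<open>fvars (ren \<rho> \<phi>) \<subseteq> {..<k + k}\<close> wf_fm_ren[OF \<phi>(1)]
        unfolding e(3) by (auto simp: limit_tp_def forms_over_def)
    qed
    \<comment> \<open>Outer limit: \<open>\<phi>(a i, e)\<close> holds for every \<open>i\<close>,
      so \<open>\<phi>\<close> with parameters \<open>e\<close> belongs to the type that
      \<open>d\<close> realizes.\<close>
    ultimately have "(\<phi>, e) \<in> limit_tp L S U a k (M \<union> set e)"
      using \<phi> e(1) by (simp add: limit_tp_def forms_over_def)
    then show ?thesis
      unfolding d(3)[symmetric] by (simp add: mem_tp_iff)
  qed
  ultimately show ?thesis
    using that[of M d e] M(2) d e by blast
qed

section \<open>Closing a path of two edges to a cycle of length 4\<close>

theorem theorem5p10: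
  fixes L :: "('f, 'r) lang"
    and T :: "('f, 'r) fm set"
    and S :: "('f, 'r, 'm) struct"
    and \<kappa> :: "'k rel"
    and ind :: "'m set \<Rightarrow> 'm set \<Rightarrow> 'm set \<Rightarrow> bool"
  assumes "complete_theory L T"
    and "monster_model L T S \<kappa>"
    and "invariant_rel L S \<kappa> ind"
    and "symmetric_rel S \<kappa> ind"
    and "full_existence L S \<kappa> ind"
    and "stationary_over_models L S \<kappa> ind"
    and "weakly_transitive_over_models L S \<kappa> ind"
  shows "NSOP 4 L S"
proof (rule notI, unfold SOP_def, elim exE conjE)
  fix k p and a :: "nat \<Rightarrow> 'm list"
  assume p: "p \<subseteq> {\<phi>. wf_fm L \<phi> \<and> fvars \<phi> \<subseteq> {..<2 * k}}"
    and a: "\<forall>i. length (a i) = k \<and> set (a i) \<subseteq> dom S"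
    and lt: "\<forall>i j. (\<forall>\<phi>\<in>p. sat S ((!) (a i @ a j)) \<phi>) \<longleftrightarrow> i < j"
    and inconsistent: "\<not> cycle_consistent S 4 k p"
  have increasing: "\<forall>i j. i < j \<longrightarrow> (\<forall>\<phi>\<in>p. sat S ((!) (a i @ a j)) \<phi>)"
    using lt by blast
  have S: "is_struct L S" and \<kappa>: "Card_order \<kappa>" "natLeq <o \<kappa>" and hom: "strongly_homogeneous L S \<kappa>"
    using assms(2) unfolding monster_model_def by auto
  obtain M y z where model: "small_model L S \<kappa> M"
    and len: "length y = k" "length z = k" and dom: "set y \<subseteq> dom S" "set z \<subseteq> dom S"
    and yz: "tp L S y M = tp L S z M" "coheir_indep L S y M z"
      "\<forall>\<phi>\<in>p. sat S ((!) (y @ z)) \<phi>"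
    by (rule coheir_pair_of_increasing_sequence[OF assms(2) p a[rule_format] increasing]) blast
  have M: "small S \<kappa> M" "M \<subseteq> dom S"
    using model unfolding small_model_def small_def by auto
  have sm: "small S \<kappa> (set u)" if "set u \<subseteq> dom S" for u
    using small_set[OF \<kappa>(2) that] .
  have smM: "small S \<kappa> (M \<union> set u)" if "set u \<subseteq> dom S" for u
    using small_Un[OF \<kappa> M(1) sm[OF that]] .
  have p_map: "sat S ((!) (map \<sigma> u @ map \<sigma> v)) \<phi>"
    if "automorphism L S \<sigma>" "length u = k" "length v = k" "set u \<subseteq> dom S" "set v \<subseteq> dom S"
      "\<phi> \<in> p" "sat S ((!) (u @ v)) \<phi>" for \<sigma> u v \<phi>
    using sat_map_automorphism[OF S that(1), of \<phi> "u @ v"] subsetD[OF p that(6)] that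
    by (simp add: mult_2)
  have map_dom: "set (map \<sigma> u) \<subseteq> dom S" if "automorphism L S \<sigma>" "set u \<subseteq> dom S" for \<sigma> u
    using that unfolding automorphism_def bij_betw_def by auto
  \<comment> \<open>With \<open>x\<close> as the image of \<open>y\<close>, the pair
    \<open>(y, z)\<close> is carried to \<open>(x, y)\<close>. So \<open>x\<close>, \<open>y\<close>
    inherit both \<open>p\<close> and the coheir property over \<open>M\<close>.\<close>
  obtain \<sigma> where \<sigma>: "automorphism L S \<sigma>" "\<And>x. x \<in> M \<Longrightarrow> \<sigma> x = x" "map \<sigma> z = y"
    using automorphism_of_tp_eq[OF hom smM[OF dom(2)] dom(1) _ yz(1)[symmetric]] len by auto
  define x where "x = map \<sigma> y"
  have x: "length x = k" "set x \<subseteq> dom S"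
    using len(1) map_dom[OF \<sigma>(1) dom(1)] by (auto simp: x_def)
  have xy: "coheir_indep L S x M y"
    using coheir_indep_map_automorphism[OF S \<sigma>(1) M(2) \<sigma>(2) dom yz(2)] by (simp add: \<sigma>(3) x_def)
  have p_xy: "sat S ((!) (x @ y)) \<phi>" if "\<phi> \<in> p" for \<phi>
    using p_map[OF \<sigma>(1) len dom that bspec[OF yz(3) that]] by (simp add: \<sigma>(3) x_def)
  have tp_x: "tp L S x M = tp L S z M"
    using tp_map_automorphism[OF S \<sigma>(1) M(2) \<sigma>(2) dom(1)] yz(1) by (simp add: x_def)

  obtain A' where A': "set_equiv_over L S (M \<union> set y) A' (set z)" "ind A' (M \<union> set y) (set x)"
    using assms(5)[unfolded full_existence_def, rule_format,
        OF sm[OF dom(2)] sm[OF x(2)] smM[OF dom(1)]] by blast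
  then obtain f where f: "f ` set z = A'" "elementary_map_over L S (M \<union> set y) f (set z)"
    unfolding set_equiv_over_def by blast
  \<comment> \<open>Full existence yields only a set; the elementary map behind it restores the
    enumeration of the tuple.\<close>
  define z' where "z' = map f z"
  have z': "length z' = k" "set z' \<subseteq> dom S" "tp L S z' (M \<union> set y) = tp L S z (M \<union> set y)"
    using f(2) len unfolding elementary_map_over_def z'_def by auto
  have ind1: "ind (set z') (M \<union> set y) (set x)"
    using A'(2) f(1) by (simp add: z'_def)
  \<comment> \<open>This automorphism carries \<open>(y, z)\<close> to \<open>(y, z')\<close> over
    \<open>M\<close>. Hence \<open>p\<close> holds of \<open>y\<close>, \<open>z'\<close>, and
    \<open>y\<close> is coheir independent from \<open>z'\<close>, which is the heir condition for
    \<open>z'\<close>.\<close>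
  obtain \<tau> where \<tau>: "automorphism L S \<tau>" "\<And>x. x \<in> M \<union> set y \<Longrightarrow> \<tau> x = x" "map \<tau> z = z'"
    using automorphism_of_tp_eq[OF hom small_Un[OF \<kappa> smM[OF dom(1)] sm[OF dom(2)]] z'(2) _
        z'(3)[symmetric]] len z' by auto
  have \<tau>_y: "map \<tau> y = y"
    using \<tau>(2) by (simp add: map_idI)
  have heir: "heir_indep L S z' M y"
    using coheir_indep_map_automorphism[OF S \<tau>(1) M(2) _ dom yz(2)] \<tau>
    by (simp add: \<tau>_y heir_indep_def)
  have p_yz': "sat S ((!) (y @ z')) \<phi>" if "\<phi> \<in> p" for \<phi>
    using p_map[OF \<tau>(1) len dom that bspec[OF yz(3) that]] by (simp add: \<tau>(3) \<tau>_y)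
  \<comment> \<open>Weak transitivity with \<open>y\<close> as the middle tuple: \<open>z'\<close>
    meets the heir condition and \<open>x\<close> the coheir condition.\<close>
  have ind: "ind (set z') M (set x)"
    using assms(7)[unfolded weakly_transitive_over_models_def, rule_format,
        OF model z'(2) x(2) dom(1) ind1 heir xy] .
  have tp_z': "tp L S z' M = tp L S x M"
    using tp_mono_eq[OF z'(3), of M] z'(1) len tp_x by simp

  \<comment> \<open>The pair \<open>(z', x)\<close> goes to \<open>(x, x')\<close>. By invariance
    and symmetry, \<open>x'\<close> is then independent from \<open>x\<close> over \<open>M\<close>,
    just as \<open>z'\<close> is.\<close>
  obtain \<alpha> where \<alpha>: "automorphism L S \<alpha>" "\<And>x. x \<in> M \<Longrightarrow> \<alpha> x = x" "map \<alpha> z' = x"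
    using automorphism_of_tp_eq[OF hom smM[OF z'(2)] x(2) _ tp_z'] x z' by auto
  define x' where "x' = map \<alpha> x"
  have x': "length x' = k" "set x' \<subseteq> dom S"
    using x(1) map_dom[OF \<alpha>(1) x(2)] by (auto simp: x'_def)
  have "ind (\<alpha> ` set z') (\<alpha> ` M) (\<alpha> ` set x)"
    using assms(3)[unfolded invariant_rel_def, rule_format,
        OF sm[OF z'(2)] sm[OF x(2)] M(1) \<alpha>(1) ind] .
  moreover have "\<alpha> ` M = M"
    using \<alpha>(2) by simp
  ultimately have "ind (set x) M (set x')"
    using \<alpha>(3) by (metis set_map x'_def)
  then have ind': "ind (set x') M (set x)"
    using assms(4)[unfolded symmetric_rel_def, rule_format,
        OF sm[OF x'(2)] sm[OF x(2)] M(1)] by blast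
  have tp_x': "tp L S x' M = tp L S z' M"
    using tp_map_automorphism[OF S \<alpha>(1) M(2) \<alpha>(2) x(2)] tp_z' by (simp add: x'_def)
  \<comment> \<open>Stationarity lets \<open>x'\<close> be moved to \<open>z'\<close> with
    \<open>x\<close> held fixed. The resulting \<beta> composed after \<alpha> exchanges
    \<open>z'\<close> and \<open>x\<close> and fixes \<open>M\<close> pointwise.\<close>
  have "tp L S x' (M \<union> set x) = tp L S z' (M \<union> set x)"
    using assms(6)[unfolded stationary_over_models_def, rule_format,
        OF model x'(2) z'(2) x(2) tp_x' ind' ind] .
  then obtain \<beta> where \<beta>: "automorphism L S \<beta>" "\<And>u. u \<in> M \<union> set x \<Longrightarrow> \<beta> u = u" "map \<beta> x' = z'"
    using automorphism_of_tp_eq[OF hom small_Un[OF \<kappa> smM[OF x(2)] sm[OF x'(2)]] z'(2)] x' z' by auto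
  have \<beta>_x: "map \<beta> x = x"
    using \<beta>(2) by (simp add: map_idI)
  \<comment> \<open>The exchange turns the edges of the path \<open>x\<close>, \<open>y\<close>,
    \<open>z'\<close> into edges from \<open>z'\<close> to \<open>y'\<close> and from
    \<open>y'\<close> to \<open>x\<close>.\<close>
  define y' where "y' = map \<beta> (map \<alpha> y)"
  note \<alpha>_y = map_dom[OF \<alpha>(1) dom(1)]
  have y': "length y' = k" "set y' \<subseteq> dom S"
    using len(1) map_dom[OF \<beta>(1) \<alpha>_y] by (auto simp: y'_def)
  have p_z'y': "sat S ((!) (z' @ y')) \<phi>" if "\<phi> \<in> p" for \<phi>
    using p_map[OF \<beta>(1) _ _ _ \<alpha>_y that p_map[OF \<alpha>(1) x(1) len(1) x(2) dom(1) that p_xy[OF that]]] len x'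
    by (simp add: y'_def \<beta>(3) flip: x'_def)
  have p_y'x: "sat S ((!) (y' @ x)) \<phi>" if "\<phi> \<in> p" for \<phi>
    using p_map[OF \<beta>(1) _ _ \<alpha>_y _ that p_map[OF \<alpha>(1) len(1) z'(1) dom(1) z'(2) that p_yz'[OF that]]] len x
    by (simp add: y'_def \<alpha>(3) \<beta>_x)

  \<comment> \<open>The four tuples satisfy all of \<open>p\<close>, so one choice serves every
    finite part \<open>q\<close>. For \<open>i = 3\<close> the successor modulo 4 is 0, which is the
    edge from \<open>y'\<close> back to \<open>x\<close>.\<close>
  have "cycle_consistent S 4 k p"
    unfolding cycle_consistent_def
  proof (intro allI impI exI conjI ballI)
    fix q i assume "q \<subseteq> p" and i: "i < (4 :: nat)"
    let ?w = "(!) [x, y, z', y']"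
    have i: "i \<in> {0, 1, 2, 3}"
      using i by auto
    show "length (?w i) = k" "set (?w i) \<subseteq> dom S"
      using i x y' z' len dom by auto
    show "sat S ((!) (?w i @ ?w (Suc i mod 4))) \<phi>" if "\<phi> \<in> q" for \<phi>
      using i p_xy p_yz' p_z'y' p_y'x that \<open>q \<subseteq> p\<close> by auto
  qed
  with inconsistent show False ..
qed

end
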